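(* Let $\mu>0$ and let $g$ satisfy $(g_1)$ and $(g_2)$ (with constants $\eta>\delta>0$). Let $E_\eta=\{u\in X_0^s(\Omega):\|u\|_{L^\infty(\Omega)}\le\eta\}$ and let $\mathcal{E}$ be the functional $$\mathcal{E}(u)=\frac12\int_{\mathbb{R}^{2N}}\frac{|u(x)-u(y)|^2}{|x-y|^{N+2s}}dxdy+\frac\mu2\int_\Omega|u|^2dx-\int_\Omega G(u)dx.$$ Then (i) the infimum of $\mathcal{E}$ over $E_\eta$ is attained at some $u_0\in E_\eta$; (ii) $u_0$ is a weak solution of $$(-\Delta)^su+\mu u=g(u),\ u\ge0\text{ in }\Omega,\qquad u=0\text{ in }\mathbb{R}^N\setminus\Omega,$$ and $0\le u_0(x)\le\delta$ for a.e. $x\in\Omega$.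
   Context: $\Omega\subset\mathbb{R}^N$ ($N>2s$) is a bounded smooth domain, $s\in(0,1)$, $X_0^s(\Omega)=\{u\in H^s(\mathbb{R}^N): u=0 \text{ a.e. in }\mathbb{R}^N\setminus\Omega\}$. $(g_1)$: $g:[0,\infty)\to\mathbb{R}$ is continuous and bounded with $g(0)=0$. $(g_2)$: there exist $\eta>\delta>0$ with $g(t)\le0$ for all $t\in[\delta,\eta]$. $g$ is extended by $0$ on $(-\infty,0]$, $G(t)=\int_0^tg$. A weak solution of the problem means $u\in X_0^s(\Omega)$ with $\int_{\mathbb{R}^{2N}}\frac{(u(x)-u(y))(\varphi(x)-\varphi(y))}{|x-y|^{N+2s}}dxdy+\mu\int_\Omega u\varphi=\int_\Omega g(u)\varphi$ for all $\varphi\in X_0^s(\Omega)$. *)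

theory Defs
  imports "HOL-Analysis.Analysis"
begin

coinductive smooth_on :: "'a::euclidean_space set \<Rightarrow> ('a \<Rightarrow> real) \<Rightarrow> bool" where
  "f differentiable_on U \<Longrightarrow> (\<forall>v. smooth_on U (\<lambda>x. frechet_derivative f (at x) v))
     \<Longrightarrow> smooth_on U f"

text \<open>Bounded smooth domain: bounded, open, connected, with C-infinity boundary
  (locally a regular sublevel set of a smooth function).\<close>
definition bounded_smooth_domain :: "'a::euclidean_space set \<Rightarrow> bool" where
  "bounded_smooth_domain \<Omega> \<longleftrightarrow> open \<Omega> \<and> bounded \<Omega> \<and> connected \<Omega> \<and> \<Omega> \<noteq> {} \<and>
     (\<forall>p\<in>frontier \<Omega>. \<exists>U \<phi>. open U \<and> p \<in> U \<and> smooth_on U \<phi> \<and>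
        (\<forall>x\<in>U. \<exists>v. frechet_derivative \<phi> (at x) v \<noteq> 0) \<and>
        \<Omega> \<inter> U = {x\<in>U. \<phi> x < 0})"

definition gagliardo :: "real \<Rightarrow> ('a::euclidean_space \<Rightarrow> real) \<Rightarrow> ennreal" where
  "gagliardo s u = (\<integral>\<^sup>+ z. ennreal ((u (fst z) - u (snd z))\<^sup>2 /
        norm (fst z - snd z) powr (real DIM('a) + 2 * s)) \<partial>(lborel \<Otimes>\<^sub>M lborel))"

definition Hs :: "real \<Rightarrow> ('a::euclidean_space \<Rightarrow> real) set" where
  "Hs s = {u. u \<in> borel_measurable lborel \<and> integrable lborel (\<lambda>x. (u x)\<^sup>2)
              \<and> gagliardo s u < \<infinity>}"

definition X0 :: "real \<Rightarrow> 'a::euclidean_space set \<Rightarrow> ('a \<Rightarrow> real) set" where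
  "X0 s \<Omega> = {u \<in> Hs s. AE x in lborel. x \<notin> \<Omega> \<longrightarrow> u x = 0}"

definition gext :: "(real \<Rightarrow> real) \<Rightarrow> real \<Rightarrow> real" where
  "gext g t = (if t \<le> 0 then 0 else g t)"

definition Gprim :: "(real \<Rightarrow> real) \<Rightarrow> real \<Rightarrow> real" where
  "Gprim g t = (LBINT \<tau>=0..t. gext g \<tau>)"

definition E_eta :: "real \<Rightarrow> 'a::euclidean_space set \<Rightarrow> real \<Rightarrow> ('a \<Rightarrow> real) set" where
  "E_eta s \<Omega> \<eta> = {u \<in> X0 s \<Omega>. AE x in lborel. x \<in> \<Omega> \<longrightarrow> \<bar>u x\<bar> \<le> \<eta>}"

definition energy :: "real \<Rightarrow> 'a::euclidean_space set \<Rightarrow> real \<Rightarrow> (real \<Rightarrow> real)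
                       \<Rightarrow> ('a \<Rightarrow> real) \<Rightarrow> real" where
  "energy s \<Omega> \<mu> g u = (1/2) * enn2real (gagliardo s u)
      + (\<mu>/2) * (LINT x:\<Omega>|lborel. (u x)\<^sup>2)
      - (LINT x:\<Omega>|lborel. Gprim g (u x))"

definition weak_solution :: "real \<Rightarrow> 'a::euclidean_space set \<Rightarrow> real \<Rightarrow> (real \<Rightarrow> real)
                       \<Rightarrow> ('a \<Rightarrow> real) \<Rightarrow> bool" where
  "weak_solution s \<Omega> \<mu> g u \<longleftrightarrow> u \<in> X0 s \<Omega> \<and>
     (\<forall>\<phi>\<in>X0 s \<Omega>.
        (\<integral>z. (u (fst z) - u (snd z)) * (\<phi> (fst z) - \<phi> (snd z)) /
              norm (fst z - snd z) powr (real DIM('a) + 2 * s) \<partial>(lborel \<Otimes>\<^sub>M lborel))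
        + \<mu> * (LINT x:\<Omega>|lborel. u x * \<phi> x)
        = (LINT x:\<Omega>|lborel. gext g (u x) * \<phi> x))"

end

theory Submission
  imports Defs
begin

text \<open>Freezing \<open>g\<close> beyond \<open>\<eta>\<close> at its value \<open>g \<eta> \<le> 0\<close> does not change the energy on the
  order interval, and makes truncation to \<open>[0, \<delta>]\<close> decrease the energy on all of \<open>X\<^sub>0\<close>. Hence a
  minimizer among functions with values in \<open>[0, \<delta>]\<close> is a global one, and the weak equation is the
  vanishing of the derivative of the energy in every direction of \<open>X\<^sub>0\<close>.

  Existence of the minimizer needs no compact embedding. The energy is submodular with respect to
  pointwise maximum and minimum, so if \<open>u\<^sub>n\<close> has energy at most \<open>inf + 2^-n\<close>, then
  the maximum of \<open>u\<^sub>n, \<dots>, u\<^sub>m\<close> has energy at most \<open>inf + 2 * 2^-n\<close>. Applying Fatou's lemma to these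
  monotone limits twice shows that the pointwise upper limit of \<open>u\<^sub>n\<close> is a minimizer.\<close>

section \<open>Pointwise estimates for the Gagliardo integrand\<close>

definition gform ::
  "real \<Rightarrow> ('a::euclidean_space \<Rightarrow> real) \<Rightarrow> ('a \<Rightarrow> real) \<Rightarrow> 'a \<times> 'a \<Rightarrow> real" where
  "gform s u v z = (u (fst z) - u (snd z)) * (v (fst z) - v (snd z)) /
      norm (fst z - snd z) powr (real DIM('a) + 2 * s)"

lemma gform_measurable [measurable]:
  assumes [measurable]: "u \<in> borel_measurable borel" "v \<in> borel_measurable borel"
  shows "gform s u v \<in> borel_measurable (lborel \<Otimes>\<^sub>M lborel)"
  unfolding gform_def by measurable

lemma gform_nonneg: "0 \<le> gform s u u z"
  by (simp add: gform_def)

lemma gagliardo_gform: "gagliardo s u = (\<integral>\<^sup>+ z. ennreal (gform s u u z) \<partial>(lborel \<Otimes>\<^sub>M lborel))"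
  by (simp add: gagliardo_def gform_def power2_eq_square)

lemma gform_mono:
  assumes "\<bar>v (fst z) - v (snd z)\<bar> \<le> \<bar>u (fst z) - u (snd z)\<bar>"
  shows "gform s v v z \<le> gform s u u z"
proof -
  have "(v (fst z) - v (snd z))\<^sup>2 \<le> (u (fst z) - u (snd z))\<^sup>2"
    using assms by (simp add: abs_le_square_iff)
  then show ?thesis
    by (simp add: gform_def power2_eq_square divide_right_mono)
qed

lemma abs_mult_le_sum_squares: "\<bar>a * b\<bar> \<le> a\<^sup>2 + b\<^sup>2" for a b :: real
proof -
  have "2 * \<bar>a * b\<bar> \<le> a\<^sup>2 + b\<^sup>2"
    using sum_squares_bound[of "\<bar>a\<bar>" "\<bar>b\<bar>"] by (simp add: abs_mult)
  then show ?thesis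
    using abs_ge_zero[of "a * b"] by linarith
qed

lemma gform_abs_le: "\<bar>gform s u v z\<bar> \<le> gform s u u z + gform s v v z"
  unfolding gform_def add_divide_distrib[symmetric] abs_divide
  using abs_mult_le_sum_squares[of "u (fst z) - u (snd z)" "v (fst z) - v (snd z)"]
  by (simp add: divide_right_mono power2_eq_square)

lemma gform_add_scaled:
  "gform s (\<lambda>x. u x + t * v x) (\<lambda>x. u x + t * v x) z
    = gform s u u z + 2 * t * gform s u v z + t\<^sup>2 * gform s v v z"
  unfolding gform_def
  by (simp add: add_divide_distrib[symmetric] power2_eq_square algebra_simps)

text \<open>If \<open>a - b\<close> and \<open>c - d\<close> have the same sign, both sides agree.
  Otherwise left minus right equals \<open>2 * (a - b) * (c - d)\<close>, which is
  nonpositive.\<close>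

lemma max_min_square_le:
  fixes a b c d :: real
  shows "(max a b - max c d)\<^sup>2 + (min a b - min c d)\<^sup>2 \<le> (a - c)\<^sup>2 + (b - d)\<^sup>2"
proof -
  consider "a \<le> b" "c \<le> d" | "a \<le> b" "d \<le> c" | "b \<le> a" "c \<le> d" | "b \<le> a" "d \<le> c"
    by linarith
  then show ?thesis
  proof cases
    case 2
    have "(a - b) * (c - d) \<le> 0" using 2 by (simp add: mult_nonpos_nonneg)
    then show ?thesis using 2 by (simp add: power2_eq_square algebra_simps)
  next
    case 3
    have "(a - b) * (c - d) \<le> 0" using 3 by (simp add: mult_nonneg_nonpos)
    then show ?thesis using 3 by (simp add: power2_eq_square algebra_simps)
  qed auto
qed

text \<open>Source of the submodularity of the energy. Dropping either nonnegative term on the left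
  gives the domination that keeps maxima and minima in \<open>X0\<close>.\<close>

lemma gform_max_min:
  "gform s (\<lambda>x. max (u x) (v x)) (\<lambda>x. max (u x) (v x)) z
    + gform s (\<lambda>x. min (u x) (v x)) (\<lambda>x. min (u x) (v x)) z
   \<le> gform s u u z + gform s v v z"
  unfolding gform_def add_divide_distrib[symmetric]
  using max_min_square_le[of "u (fst z)" "v (fst z)" "u (snd z)" "v (snd z)"]
  by (intro divide_right_mono) (auto simp: power2_eq_square)

lemma gform_max_le:
  "gform s (\<lambda>x. max (u x) (v x)) (\<lambda>x. max (u x) (v x)) z \<le> gform s u u z + gform s v v z"
  and gform_min_le:
  "gform s (\<lambda>x. min (u x) (v x)) (\<lambda>x. min (u x) (v x)) z \<le> gform s u u z + gform s v v z"
  using gform_max_min[of s u v z] gform_nonneg[of s "\<lambda>x. max (u x) (v x)" z]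
    gform_nonneg[of s "\<lambda>x. min (u x) (v x)" z] by linarith+

section \<open>The space \<open>X0\<close>: integrability, linear combinations, lattice
  operations\<close>

lemma X0_iff:
  "u \<in> X0 s \<Omega> \<longleftrightarrow> u \<in> borel_measurable borel \<and> integrable lborel (\<lambda>x. (u x)\<^sup>2)
     \<and> integrable (lborel \<Otimes>\<^sub>M lborel) (gform s u u)
     \<and> (AE x in lborel. x \<notin> \<Omega> \<longrightarrow> u x = 0)"
proof -
  \<comment> \<open>For this nonnegative integrand a finite \<open>ennreal\<close> integral amounts
    to Bochner integrability, so later estimates can use real integrals.\<close>
  have "integrable (lborel \<Otimes>\<^sub>M lborel) (gform s u u) \<longleftrightarrow> gagliardo s u < \<infinity>"
    if "u \<in> borel_measurable borel"
    using that by (simp add: integrable_iff_bounded gagliardo_gform gform_nonneg)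
  then show ?thesis
    by (auto simp: X0_def Hs_def)
qed

lemma gagliardo_eq_integral:
  assumes "u \<in> X0 s \<Omega>"
  shows "gagliardo s u = ennreal (\<integral>z. gform s u u z \<partial>(lborel \<Otimes>\<^sub>M lborel))"
  unfolding gagliardo_gform using assms
  by (intro nn_integral_eq_integral) (auto simp: X0_iff gform_nonneg)

lemma enn2real_gagliardo:
  assumes "u \<in> X0 s \<Omega>"
  shows "enn2real (gagliardo s u) = (\<integral>z. gform s u u z \<partial>(lborel \<Otimes>\<^sub>M lborel))"
  by (simp add: gagliardo_eq_integral[OF assms] gform_nonneg)

lemma X0_measurable [dest]: "u \<in> X0 s \<Omega> \<Longrightarrow> u \<in> borel_measurable borel"
  by (simp add: X0_iff)

lemma integrable_gform:
  assumes "u \<in> X0 s \<Omega>" "v \<in> X0 s \<Omega>"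
  shows "integrable (lborel \<Otimes>\<^sub>M lborel) (gform s u v)"
proof (rule Bochner_Integration.integrable_bound)
  show "integrable (lborel \<Otimes>\<^sub>M lborel) (\<lambda>z. gform s u u z + gform s v v z)"
    using assms by (auto simp: X0_iff)
  show "AE z in lborel \<Otimes>\<^sub>M lborel. norm (gform s u v z) \<le> norm (gform s u u z + gform s v v z)"
    using gform_abs_le[of s u v] by (simp add: gform_nonneg)
qed (intro gform_measurable X0_measurable[OF assms(1)] X0_measurable[OF assms(2)])

lemma integrable_X0_mult:
  assumes "u \<in> X0 s \<Omega>" "v \<in> X0 s \<Omega>"
  shows "integrable lborel (\<lambda>x. u x * v x)"
proof (rule Bochner_Integration.integrable_bound)
  show "integrable lborel (\<lambda>x. (u x)\<^sup>2 + (v x)\<^sup>2)"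
    using assms by (auto simp: X0_iff)
  show "AE x in lborel. norm (u x * v x) \<le> norm ((u x)\<^sup>2 + (v x)\<^sup>2)"
    using abs_mult_le_sum_squares by simp
  have [measurable]: "u \<in> borel_measurable borel" "v \<in> borel_measurable borel"
    using assms by auto
  show "(\<lambda>x. u x * v x) \<in> borel_measurable lborel" by measurable
qed

lemma X0_zero: "(\<lambda>x. 0) \<in> X0 s \<Omega>"
  by (simp add: X0_iff gform_def[abs_def])

lemma X0_add_scaled:
  assumes "u \<in> X0 s \<Omega>" "v \<in> X0 s \<Omega>"
  shows "(\<lambda>x. u x + t * v x) \<in> X0 s \<Omega>"
  unfolding X0_iff
proof (intro conjI)
  have [measurable]: "u \<in> borel_measurable borel" "v \<in> borel_measurable borel"
    using assms by auto
  show "(\<lambda>x. u x + t * v x) \<in> borel_measurable borel" by measurable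
  have "(\<lambda>x. (u x + t * v x)\<^sup>2) = (\<lambda>x. (u x)\<^sup>2 + 2 * t * (u x * v x) + t\<^sup>2 * (v x)\<^sup>2)"
    by (simp add: power2_eq_square algebra_simps)
  then show "integrable lborel (\<lambda>x. (u x + t * v x)\<^sup>2)"
    using assms integrable_X0_mult[OF assms] by (auto simp: X0_iff)
  show "integrable (lborel \<Otimes>\<^sub>M lborel) (gform s (\<lambda>x. u x + t * v x) (\<lambda>x. u x + t * v x))"
    unfolding gform_add_scaled[abs_def]
    using assms integrable_gform[OF assms] by (auto simp: X0_iff)
  have "AE x in lborel. x \<notin> \<Omega> \<longrightarrow> u x = 0" "AE x in lborel. x \<notin> \<Omega> \<longrightarrow> v x = 0"
    using assms by (auto simp: X0_iff)
  then show "AE x in lborel. x \<notin> \<Omega> \<longrightarrow> u x + t * v x = 0"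
    by eventually_elim auto
qed

text \<open>Both integrands of \<open>v\<close> are dominated by those of \<open>u\<close>, so
  contractions such as truncation act on \<open>X0\<close>. The bound on \<open>v\<close> also
  carries over the vanishing outside \<Omega>.\<close>

lemma X0_contraction:
  assumes u: "u \<in> X0 s \<Omega>" and v [measurable]: "v \<in> borel_measurable borel"
    and diff: "\<And>x y. \<bar>v x - v y\<bar> \<le> \<bar>u x - u y\<bar>" and bound: "\<And>x. \<bar>v x\<bar> \<le> \<bar>u x\<bar>"
  shows "v \<in> X0 s \<Omega>"
  unfolding X0_iff
proof (intro conjI)
  show "integrable lborel (\<lambda>x. (v x)\<^sup>2)"
  proof (rule Bochner_Integration.integrable_bound)
    show "integrable lborel (\<lambda>x. (u x)\<^sup>2)" using u by (simp add: X0_iff)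
    show "AE x in lborel. norm ((v x)\<^sup>2) \<le> norm ((u x)\<^sup>2)"
      using bound by (simp add: abs_le_square_iff)
  qed measurable
  show "integrable (lborel \<Otimes>\<^sub>M lborel) (gform s v v)"
  proof (rule Bochner_Integration.integrable_bound)
    show "integrable (lborel \<Otimes>\<^sub>M lborel) (gform s u u)" using u by (simp add: X0_iff)
    show "AE z in lborel \<Otimes>\<^sub>M lborel. norm (gform s v v z) \<le> norm (gform s u u z)"
      by (auto simp: gform_nonneg intro!: always_eventually gform_mono diff)
  qed measurable
  have "AE x in lborel. x \<notin> \<Omega> \<longrightarrow> u x = 0"
    using u by (auto simp: X0_iff)
  then show "AE x in lborel. x \<notin> \<Omega> \<longrightarrow> v x = 0"
    by eventually_elim (use bound in \<open>metis abs_le_zero_iff abs_zero\<close>)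
qed (rule v)

text \<open>A maximum or minimum need not be a contraction of either function, so domination is by
  the sum of the two integrands.\<close>

lemma X0_max_min:
  assumes u: "u \<in> X0 s \<Omega>" and v: "v \<in> X0 s \<Omega>"
  shows X0_max: "(\<lambda>x. max (u x) (v x)) \<in> X0 s \<Omega>"
    and X0_min: "(\<lambda>x. min (u x) (v x)) \<in> X0 s \<Omega>"
proof -
  have [measurable]: "u \<in> borel_measurable borel" "v \<in> borel_measurable borel"
    using assms by auto
  have sq: "integrable lborel (\<lambda>x. (u x)\<^sup>2 + (v x)\<^sup>2)"
    and gf: "integrable (lborel \<Otimes>\<^sub>M lborel) (\<lambda>z. gform s u u z + gform s v v z)"
    using assms by (auto simp: X0_iff)
  have ae: "AE x in lborel. x \<notin> \<Omega> \<longrightarrow> u x = 0 \<and> v x = 0"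
    using assms by (auto simp: X0_iff)
  show "(\<lambda>x. max (u x) (v x)) \<in> X0 s \<Omega>"
    unfolding X0_iff
  proof (intro conjI)
    show "integrable lborel (\<lambda>x. (max (u x) (v x))\<^sup>2)"
      by (rule Bochner_Integration.integrable_bound[OF sq]) (auto simp: max_def)
    show "integrable (lborel \<Otimes>\<^sub>M lborel) (gform s (\<lambda>x. max (u x) (v x)) (\<lambda>x. max (u x) (v x)))"
    proof (rule Bochner_Integration.integrable_bound[OF gf])
      show "AE z in lborel \<Otimes>\<^sub>M lborel. norm (gform s (\<lambda>x. max (u x) (v x)) (\<lambda>x. max (u x) (v x)) z)
          \<le> norm (gform s u u z + gform s v v z)"
        using gform_max_le[of s u v] by (simp add: gform_nonneg)
    qed measurable
    show "AE x in lborel. x \<notin> \<Omega> \<longrightarrow> max (u x) (v x) = 0"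
      using ae by eventually_elim auto
  qed measurable
  show "(\<lambda>x. min (u x) (v x)) \<in> X0 s \<Omega>"
    unfolding X0_iff
  proof (intro conjI)
    show "integrable lborel (\<lambda>x. (min (u x) (v x))\<^sup>2)"
      by (rule Bochner_Integration.integrable_bound[OF sq]) (auto simp: min_def)
    show "integrable (lborel \<Otimes>\<^sub>M lborel) (gform s (\<lambda>x. min (u x) (v x)) (\<lambda>x. min (u x) (v x)))"
    proof (rule Bochner_Integration.integrable_bound[OF gf])
      show "AE z in lborel \<Otimes>\<^sub>M lborel. norm (gform s (\<lambda>x. min (u x) (v x)) (\<lambda>x. min (u x) (v x)) z)
          \<le> norm (gform s u u z + gform s v v z)"
        using gform_min_le[of s u v] by (simp add: gform_nonneg)
    qed measurable
    show "AE x in lborel. x \<notin> \<Omega> \<longrightarrow> min (u x) (v x) = 0"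
      using ae by eventually_elim auto
  qed measurable
qed

section \<open>Passing to the limit under the integral\<close>

lemma gagliardo_Fatou:
  fixes v :: "nat \<Rightarrow> 'a::euclidean_space \<Rightarrow> real"
  assumes [measurable]: "\<And>k. v k \<in> borel_measurable borel"
    and lim: "\<And>x. (\<lambda>k. v k x) \<longlonglongrightarrow> w x"
  shows "gagliardo s w \<le> liminf (\<lambda>k. gagliardo s (v k))"
proof -
  have "(\<lambda>k. gform s (v k) (v k) z) \<longlonglongrightarrow> gform s w w z" for z
    unfolding gform_def divide_inverse by (intro tendsto_mult tendsto_diff tendsto_const lim)
  \<comment> \<open>In \<open>ennreal\<close>, Fatou's lemma applies before the limit is known to
    have a finite seminorm.\<close>
  then have "ennreal (gform s w w z) = liminf (\<lambda>k. ennreal (gform s (v k) (v k) z))" for z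
    by (intro lim_imp_Liminf[symmetric] tendsto_ennrealI) auto
  then show ?thesis
    unfolding gagliardo_gform by (simp only:) (intro nn_integral_liminf, measurable)
qed

lemma set_integral_dominated_convergence:
  fixes f :: "'a \<Rightarrow> real"
  assumes [measurable]: "A \<in> sets M" "f \<in> borel_measurable M" "\<And>i::nat. F i \<in> borel_measurable M"
    and w: "set_integrable M A w"
    and lim: "\<And>x. x \<in> A \<Longrightarrow> (\<lambda>i. F i x) \<longlonglongrightarrow> f x"
    and bound: "\<And>i x. x \<in> A \<Longrightarrow> \<bar>F i x\<bar> \<le> w x"
  shows "(\<lambda>i. LINT x:A|M. F i x) \<longlonglongrightarrow> (LINT x:A|M. f x)"
  unfolding set_lebesgue_integral_def
proof (rule integral_dominated_convergence)
  show "integrable M (\<lambda>x. indicator A x *\<^sub>R w x)"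
    using w by (simp add: set_integrable_def)
  show "AE x in M. (\<lambda>i. indicator A x *\<^sub>R F i x) \<longlonglongrightarrow> indicator A x *\<^sub>R f x"
    using lim by (intro always_eventually) (auto simp: indicator_def)
  show "AE x in M. norm (indicator A x *\<^sub>R F i x) \<le> indicator A x *\<^sub>R w x" for i
    using bound by (intro always_eventually) (auto simp: indicator_def)
qed measurable

section \<open>The bounded nonlinearity and its primitive\<close>

locale bounded_nonlinearity =
  fixes g :: "real \<Rightarrow> real" and M :: real
  assumes g_cont: "continuous_on {0..} g"
    and g_zero: "g 0 = 0"
    and g_bound: "\<And>t. 0 \<le> t \<Longrightarrow> \<bar>g t\<bar> \<le> M"
begin

lemma M_nonneg: "0 \<le> M"
  using g_bound[of 0] by simp

text \<open>Since \<open>g 0 = 0\<close>, extension by zero is composition with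
  \<open>max 0\<close>, so continuity is inherited without gluing at the origin.\<close>

lemma gext_max: "gext g t = g (max 0 t)"
  by (simp add: gext_def g_zero max_def)

lemma continuous_gext: "continuous_on UNIV (gext g)"
  unfolding gext_max[abs_def]
  by (rule continuous_on_compose2[OF g_cont]) (auto intro!: continuous_intros)

lemma borel_measurable_gext [measurable]: "gext g \<in> borel_measurable borel"
  using continuous_gext by (rule borel_measurable_continuous_onI)

lemma abs_gext_le: "\<bar>gext g t\<bar> \<le> M"
  unfolding gext_max by (rule g_bound) simp

lemma Gprim_DERIV: "(Gprim g has_real_derivative gext g t) (at t)"
proof -
  \<comment> \<open>This radius puts \<open>0\<close> in the interval and \<open>t\<close> in its
    interior, so the one-interval derivative is the full derivative.\<close>
  define R where "R = \<bar>t\<bar> + 1"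
  have "((\<lambda>u. LBINT y=(0::real)..u. gext g y) has_vector_derivative gext g t) (at t within {-R..R})"
    by (rule interval_integral_FTC2)
      (auto simp: R_def intro: continuous_on_subset[OF continuous_gext])
  moreover have "at t within {-R..R} = at t"
    by (rule at_within_interior) (auto simp: R_def)
  ultimately show ?thesis
    by (simp add: Gprim_def[abs_def] has_real_derivative_iff_has_vector_derivative zero_ereal_def)
qed

lemma Gprim_0 [simp]: "Gprim g 0 = 0"
  by (simp add: Gprim_def flip: zero_ereal_def)

lemma continuous_Gprim: "continuous_on UNIV (Gprim g)"
  by (rule DERIV_continuous_on) (rule DERIV_subset[OF Gprim_DERIV subset_UNIV])

lemma borel_measurable_Gprim [measurable]: "Gprim g \<in> borel_measurable borel"
  using continuous_Gprim by (rule borel_measurable_continuous_onI)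

lemma Gprim_Lipschitz: "\<bar>Gprim g a - Gprim g b\<bar> \<le> M * \<bar>a - b\<bar>"
  using field_differentiable_bound[of UNIV "Gprim g" "gext g" M a b] Gprim_DERIV abs_gext_le
  by auto

lemma abs_Gprim_le: "\<bar>Gprim g t\<bar> \<le> M * \<bar>t\<bar>"
  using Gprim_Lipschitz[of t 0] by simp

lemma Gprim_nonpos_arg:
  assumes "t \<le> 0"
  shows "Gprim g t = 0"
proof (cases "t = 0")
  case False
  then obtain z where "z < 0" "Gprim g 0 - Gprim g t = (0 - t) * gext g z"
    using MVT2[of t 0 "Gprim g" "gext g"] Gprim_DERIV assms by force
  then show ?thesis by (simp add: gext_def)
qed simp

text \<open>By the mean value theorem the increment is \<open>t - d\<close> times a value of
  \<open>gext g\<close> beyond \<open>d\<close>.\<close>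

lemma Gprim_le_of_nonpos:
  assumes neg: "\<And>t. d \<le> t \<Longrightarrow> g t \<le> 0" and "0 \<le> d" "d \<le> t"
  shows "Gprim g t \<le> Gprim g d"
proof (cases "t = d")
  case False
  then obtain z where z: "d < z" "Gprim g t - Gprim g d = (t - d) * gext g z"
    using MVT2[of d t "Gprim g" "gext g"] Gprim_DERIV assms by force
  have "gext g z \<le> 0" using z assms neg[of z] by (simp add: gext_def)
  then have "(t - d) * gext g z \<le> 0" using assms by (simp add: mult_nonneg_nonpos)
  with z show ?thesis by simp
qed simp

end

section \<open>The energy: zero-order term, truncation, submodularity\<close>

locale fractional_problem = bounded_nonlinearity g M for g M +
  fixes \<Omega> :: "'a::euclidean_space set" and s \<mu> d :: real
  assumes open_dom: "open \<Omega>" and bounded_dom: "bounded \<Omega>"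
    and mu_pos: "0 < \<mu>" and d_nonneg: "0 \<le> d"
    and g_nonpos: "\<And>t. d \<le> t \<Longrightarrow> g t \<le> 0"
begin

text \<open>The zero-order density: its integral over \<Omega> is the whole energy apart from the
  seminorm.\<close>

definition H :: "real \<Rightarrow> real" where
  "H t = \<mu> / 2 * t\<^sup>2 - Gprim g t"

text \<open>The bounds hold everywhere, not just almost everywhere, so pointwise suprema and limits
  keep them without exceptional null sets.\<close>

definition K :: "('a \<Rightarrow> real) set" where
  "K = {u \<in> X0 s \<Omega>. \<forall>x. 0 \<le> u x \<and> u x \<le> d}"

definition trunc :: "('a \<Rightarrow> real) \<Rightarrow> 'a \<Rightarrow> real" where
  "trunc u x = max 0 (min (u x) d)"

lemma dom_measurable [measurable]: "\<Omega> \<in> sets borel"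
  using open_dom by simp

lemma borel_measurable_H [measurable]: "H \<in> borel_measurable borel"
  unfolding H_def[abs_def] by measurable

lemma continuous_H: "continuous_on UNIV H"
  unfolding H_def[abs_def] by (intro continuous_intros continuous_Gprim)

lemma set_integrable_const_dom: "set_integrable lborel \<Omega> (\<lambda>x. c::real)"
proof -
  have "emeasure lborel \<Omega> < \<infinity>"
    using emeasure_bounded_finite[OF bounded_dom] .
  then have "integrable lborel (indicator \<Omega> :: 'a \<Rightarrow> real)"
    by (intro integrable_real_indicator) auto
  then show ?thesis
    unfolding set_integrable_def by simp
qed

lemma set_integrable_of_integrable:
  "integrable lborel f \<Longrightarrow> set_integrable lborel \<Omega> (f :: 'a \<Rightarrow> real)"
  unfolding set_integrable_def by (rule integrable_mult_indicator) auto

lemma set_integrable_bound_dom: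
  assumes [measurable]: "f \<in> borel_measurable borel"
    and "set_integrable lborel \<Omega> w" "\<And>x. \<bar>f x\<bar> \<le> (w x :: real)"
  shows "set_integrable lborel \<Omega> f"
proof (rule set_integrable_bound[OF assms(2)])
  show "set_borel_measurable lborel \<Omega> f"
    unfolding set_borel_measurable_def by measurable
  show "AE x in lborel. x \<in> \<Omega> \<longrightarrow> norm (f x) \<le> norm (w x)"
    using assms(3) by (intro always_eventually) (auto intro: order_trans[OF _ abs_ge_self])
qed

lemma set_integrable_square:
  assumes "u \<in> X0 s \<Omega>"
  shows "set_integrable lborel \<Omega> (\<lambda>x. (u x)\<^sup>2)"
  using assms by (intro set_integrable_of_integrable) (simp add: X0_iff)

lemma set_integrable_mult:
  assumes "u \<in> X0 s \<Omega>" "v \<in> X0 s \<Omega>"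
  shows "set_integrable lborel \<Omega> (\<lambda>x. u x * v x)"
  using integrable_X0_mult[OF assms] by (rule set_integrable_of_integrable)

text \<open>On the bounded set \<Omega> the function \<open>1 + u^2\<close> is integrable, and it
  dominates the absolute value of \<open>u\<close>.\<close>

lemma set_integrable_scaled_abs:
  assumes "u \<in> X0 s \<Omega>"
  shows "set_integrable lborel \<Omega> (\<lambda>x. c * \<bar>u x\<bar>)"
proof -
  have [measurable]: "u \<in> borel_measurable borel" using assms by auto
  have "set_integrable lborel \<Omega> (\<lambda>x. \<bar>u x\<bar>)"
  proof (rule set_integrable_bound_dom)
    show "set_integrable lborel \<Omega> (\<lambda>x. 1 + (u x)\<^sup>2)"
      using set_integrable_const_dom set_integrable_square[OF assms] by (rule set_integral_add(1))
    show "\<bar>\<bar>u x\<bar>\<bar> \<le> 1 + (u x)\<^sup>2" for x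
      using abs_mult_le_sum_squares[of 1 "u x"] by simp
  qed measurable
  then show ?thesis by simp
qed

lemma set_integrable_Gprim:
  assumes "u \<in> X0 s \<Omega>"
  shows "set_integrable lborel \<Omega> (\<lambda>x. Gprim g (u x))"
proof -
  have [measurable]: "u \<in> borel_measurable borel" using assms by auto
  show ?thesis
    by (rule set_integrable_bound_dom[OF _ set_integrable_scaled_abs[OF assms, of M]])
      (auto intro: abs_Gprim_le)
qed

lemma set_integrable_H:
  assumes "u \<in> X0 s \<Omega>"
  shows "set_integrable lborel \<Omega> (\<lambda>x. H (u x))"
  unfolding H_def
  using set_integrable_square[OF assms] set_integrable_Gprim[OF assms] by simp

lemma energy_eq:
  assumes "u \<in> X0 s \<Omega>"
  shows "energy s \<Omega> \<mu> g u
    = 1/2 * (\<integral>z. gform s u u z \<partial>(lborel \<Otimes>\<^sub>M lborel)) + (LINT x:\<Omega>|lborel. H (u x))"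
  unfolding energy_def enn2real_gagliardo[OF assms] H_def
  using set_integrable_square[OF assms] set_integrable_Gprim[OF assms]
  by (subst set_integral_diff) auto

lemma trunc_in_K:
  assumes "u \<in> X0 s \<Omega>"
  shows "trunc u \<in> K"
proof -
  have [measurable]: "u \<in> borel_measurable borel" using assms by auto
  have "trunc u \<in> X0 s \<Omega>"
  proof (rule X0_contraction[OF assms])
    show "trunc u \<in> borel_measurable borel" unfolding trunc_def[abs_def] by measurable
  qed (use d_nonneg in \<open>auto simp: trunc_def\<close>)
  then show ?thesis using d_nonneg by (simp add: K_def trunc_def)
qed

text \<open>Below \<open>0\<close> the primitive vanishes and only a nonnegative square is lost.
  Above \<open>d\<close> the square grows while the primitive does not increase.\<close>

lemma H_trunc_le: "H (trunc u x) \<le> H (u x)"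
proof -
  consider "u x \<le> 0" | "0 \<le> u x" "u x \<le> d" | "d \<le> u x" by linarith
  then show ?thesis
  proof cases
    case 1
    then show ?thesis
      using mu_pos d_nonneg Gprim_nonpos_arg[of "u x"] by (simp add: H_def trunc_def min_def)
  next
    case 3
    then have "Gprim g (u x) \<le> Gprim g d"
      using g_nonpos d_nonneg by (intro Gprim_le_of_nonpos)
    moreover have "\<mu> / 2 * d\<^sup>2 \<le> \<mu> / 2 * (u x)\<^sup>2"
      using 3 mu_pos d_nonneg by (intro mult_left_mono power_mono) auto
    ultimately show ?thesis using 3 d_nonneg by (simp add: H_def trunc_def)
  qed (simp add: trunc_def)
qed

text \<open>Truncation is 1-Lipschitz, hence does not increase the seminorm, and
  \<open>H_trunc_le\<close> treats the rest. Competitors can thus be restricted to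
  \<open>K\<close>.\<close>

lemma energy_trunc_le:
  assumes u: "u \<in> X0 s \<Omega>"
  shows "energy s \<Omega> \<mu> g (trunc u) \<le> energy s \<Omega> \<mu> g u"
proof -
  have tu: "trunc u \<in> X0 s \<Omega>" using trunc_in_K[OF u] by (simp add: K_def)
  have "(\<integral>z. gform s (trunc u) (trunc u) z \<partial>(lborel \<Otimes>\<^sub>M lborel))
      \<le> (\<integral>z. gform s u u z \<partial>(lborel \<Otimes>\<^sub>M lborel))"
    using integrable_gform[OF tu tu] integrable_gform[OF u u]
    by (rule integral_mono) (rule gform_mono, auto simp: trunc_def)
  moreover have "(LINT x:\<Omega>|lborel. H (trunc u x)) \<le> (LINT x:\<Omega>|lborel. H (u x))"
    using set_integrable_H[OF tu] set_integrable_H[OF u] H_trunc_le by (rule set_integral_mono)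
  ultimately show ?thesis
    unfolding energy_eq[OF u] energy_eq[OF tu] by simp
qed

text \<open>The seminorm part comes from \<open>gform_max_min\<close>. The zero-order part is an
  equality, as maximum and minimum only rearrange the two values at each point.\<close>

lemma energy_submodular:
  assumes u: "u \<in> X0 s \<Omega>" and v: "v \<in> X0 s \<Omega>"
  shows "energy s \<Omega> \<mu> g (\<lambda>x. max (u x) (v x)) + energy s \<Omega> \<mu> g (\<lambda>x. min (u x) (v x))
    \<le> energy s \<Omega> \<mu> g u + energy s \<Omega> \<mu> g v"
proof -
  let ?m = "\<lambda>x. max (u x) (v x)" and ?n = "\<lambda>x. min (u x) (v x)" and ?L = "lborel \<Otimes>\<^sub>M lborel"
  note X = X0_max[OF u v] X0_min[OF u v]
  have "(\<integral>z. gform s ?m ?m z + gform s ?n ?n z \<partial>?L) \<le> (\<integral>z. gform s u u z + gform s v v z \<partial>?L)"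
    by (intro integral_mono gform_max_min Bochner_Integration.integrable_add integrable_gform[where \<Omega>=\<Omega>] X u v)
  then have 1: "(\<integral>z. gform s ?m ?m z \<partial>?L) + (\<integral>z. gform s ?n ?n z \<partial>?L)
      \<le> (\<integral>z. gform s u u z \<partial>?L) + (\<integral>z. gform s v v z \<partial>?L)"
    by (simp add: integrable_gform[where \<Omega>=\<Omega>] X u v)
  have "H (?m x) + H (?n x) = H (u x) + H (v x)" for x
    by (simp add: max_def min_def)
  then have 2: "(LINT x:\<Omega>|lborel. H (?m x)) + (LINT x:\<Omega>|lborel. H (?n x))
      = (LINT x:\<Omega>|lborel. H (u x)) + (LINT x:\<Omega>|lborel. H (v x))"
    using set_integrable_H X u v by (simp flip: set_integral_add(2))
  show ?thesis
    unfolding energy_eq[OF u] energy_eq[OF v] energy_eq[OF X(1)] energy_eq[OF X(2)]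
    using 1 2 by argo
qed

section \<open>Lower bound, lower semicontinuity and existence of a minimizer\<close>

lemma abs_H_le:
  assumes "0 \<le> t" "t \<le> d"
  shows "\<bar>H t\<bar> \<le> \<mu> / 2 * d\<^sup>2 + M * d"
proof -
  have "\<bar>Gprim g t\<bar> \<le> M * d"
    using abs_Gprim_le[of t] mult_left_mono[OF _ M_nonneg, of t d] assms by simp
  moreover have "\<mu> / 2 * t\<^sup>2 \<le> \<mu> / 2 * d\<^sup>2"
    using assms mu_pos by (intro mult_left_mono power_mono) auto
  moreover have "0 \<le> \<mu> / 2 * t\<^sup>2"
    using mu_pos by simp
  ultimately show ?thesis unfolding H_def by linarith
qed

lemma energy_K_bounded_below:
  assumes "u \<in> K"
  shows "- (LINT x:\<Omega>|lborel. \<mu> / 2 * d\<^sup>2 + M * d) \<le> energy s \<Omega> \<mu> g u"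
proof -
  have u: "u \<in> X0 s \<Omega>" and r: "\<And>x. 0 \<le> u x" "\<And>x. u x \<le> d"
    using assms by (auto simp: K_def)
  have "(LINT x:\<Omega>|lborel. - (\<mu> / 2 * d\<^sup>2 + M * d)) \<le> (LINT x:\<Omega>|lborel. H (u x))"
    using set_integrable_const_dom set_integrable_H[OF u]
    by (rule set_integral_mono) (use abs_H_le[OF r] in \<open>smt (verit)\<close>)
  moreover have "0 \<le> (\<integral>z. gform s u u z \<partial>(lborel \<Otimes>\<^sub>M lborel))"
    by (simp add: gform_nonneg)
  ultimately show ?thesis
    unfolding energy_eq[OF u] set_integral_uminus[OF set_integrable_const_dom] by simp
qed

text \<open>On \<open>K\<close> the density \<open>H\<close> is uniformly bounded and \<Omega> has
  finite measure, so the zero-order part converges by domination; Fatou's lemma handles the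
  seminorm. The bound \<open>c\<close> also forces the limit to have finite seminorm.\<close>

lemma energy_lower_semicontinuous:
  assumes v: "\<And>k. v k \<in> K" and lim: "\<And>x. (\<lambda>k. v k x) \<longlonglongrightarrow> w x"
    and le: "\<And>k. energy s \<Omega> \<mu> g (v k) \<le> c"
  shows "w \<in> K \<and> energy s \<Omega> \<mu> g w \<le> c"
proof -
  have vX: "v k \<in> X0 s \<Omega>" and r: "0 \<le> v k x" "v k x \<le> d" for k x
    using v[of k] by (auto simp: K_def)
  have [measurable]: "v k \<in> borel_measurable borel" for k
    using vX by auto
  have w [measurable]: "w \<in> borel_measurable borel"
    using lim by (rule borel_measurable_LIMSEQ_real) measurable
  have wr: "0 \<le> w x" "w x \<le> d" for x
    using LIMSEQ_le_const[OF lim[of x]] LIMSEQ_le_const2[OF lim[of x]] r by blast+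
  let ?A = "\<lambda>k. \<integral>z. gform s (v k) (v k) z \<partial>(lborel \<Otimes>\<^sub>M lborel)"
  let ?R = "\<lambda>u. LINT x:\<Omega>|lborel. H (u x)"
  have limR: "(\<lambda>k. ?R (v k)) \<longlonglongrightarrow> ?R w"
  proof (rule set_integral_dominated_convergence)
    show "set_integrable lborel \<Omega> (\<lambda>x. \<mu> / 2 * d\<^sup>2 + M * d)"
      by (rule set_integrable_const_dom)
    show "(\<lambda>k. H (v k x)) \<longlonglongrightarrow> H (w x)" for x
      using continuous_on_tendsto_compose[OF continuous_H lim] by simp
    show "\<bar>H (v k x)\<bar> \<le> \<mu> / 2 * d\<^sup>2 + M * d" for k x
      using r by (rule abs_H_le)
  qed measurable
  \<comment> \<open>The energy bound becomes a bound on the seminorm whose right side converges,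
    which is what Fatou's lemma needs.\<close>
  have A: "?A k \<le> 2 * (c - ?R (v k))" for k
    using le[of k] unfolding energy_eq[OF vX] by simp
  have "liminf (\<lambda>k. gagliardo s (v k)) \<le> liminf (\<lambda>k. ennreal (2 * (c - ?R (v k))))"
    unfolding gagliardo_eq_integral[OF vX] using A by (intro Liminf_mono always_eventually allI ennreal_leI)
  also have "\<dots> = ennreal (2 * (c - ?R w))"
    by (intro lim_imp_Liminf tendsto_ennrealI tendsto_intros limR) simp
  finally have gw: "gagliardo s w \<le> ennreal (2 * (c - ?R w))"
    using gagliardo_Fatou[of v w s] lim by (simp add: order_trans)
  have ae: "AE x in lborel. x \<notin> \<Omega> \<longrightarrow> w x = 0"
  proof -
    have "AE x in lborel. \<forall>k. x \<notin> \<Omega> \<longrightarrow> v k x = 0"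
      using vX by (subst AE_all_countable) (auto simp: X0_iff)
    then show ?thesis
    proof eventually_elim
      case (elim x)
      then show ?case using lim[of x] LIMSEQ_unique[of "\<lambda>k. v k x" "w x" 0] by auto
    qed
  qed
  have "integrable lborel (\<lambda>x. (w x)\<^sup>2)"
  proof (rule Bochner_Integration.integrable_bound)
    show "integrable lborel (\<lambda>x. indicator \<Omega> x *\<^sub>R d\<^sup>2)"
      using set_integrable_const_dom unfolding set_integrable_def .
    show "AE x in lborel. norm ((w x)\<^sup>2) \<le> norm (indicator \<Omega> x *\<^sub>R d\<^sup>2)"
      using ae by eventually_elim (use wr in \<open>auto simp: indicator_def power_mono\<close>)
  qed measurable
  moreover have "gagliardo s w < \<infinity>"
    using gw by (simp add: order_le_less_trans)
  ultimately have wX: "w \<in> X0 s \<Omega>"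
    using ae by (simp add: X0_def Hs_def)
  \<comment> \<open>\<open>ennreal\<close> sends negative reals to \<open>0\<close>, so this sign is
    required to read \<open>gw\<close> as an inequality of reals.\<close>
  have "0 \<le> 2 * (c - ?R w)"
  proof (rule LIMSEQ_le_const)
    show "(\<lambda>k. 2 * (c - ?R (v k))) \<longlonglongrightarrow> 2 * (c - ?R w)"
      by (intro tendsto_intros limR)
    have "0 \<le> ?A k" for k by (simp add: gform_nonneg)
    then show "\<exists>N. \<forall>k\<ge>N. 0 \<le> 2 * (c - ?R (v k))"
      using A order_trans by blast
  qed
  with gw have "(\<integral>z. gform s w w z \<partial>(lborel \<Otimes>\<^sub>M lborel)) \<le> 2 * (c - ?R w)"
    unfolding gagliardo_eq_integral[OF wX] by simp
  then have "energy s \<Omega> \<mu> g w \<le> c"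
    unfolding energy_eq[OF wX] by simp
  then show ?thesis
    using wX wr by (simp add: K_def)
qed

lemma K_max: "u \<in> K \<Longrightarrow> v \<in> K \<Longrightarrow> (\<lambda>x. max (u x) (v x)) \<in> K"
  and K_min: "u \<in> K \<Longrightarrow> v \<in> K \<Longrightarrow> (\<lambda>x. min (u x) (v x)) \<in> K"
  using X0_max[of u s \<Omega> v] X0_min[of u s \<Omega> v] by (auto simp: K_def le_max_iff_disj min_le_iff_disj)

text \<open>The infimum is taken over \<open>K\<close> only; truncation then extends minimality to
  all of \<open>X0\<close>.\<close>

lemma exists_minimizer:
  "\<exists>w\<in>K. \<forall>u\<in>X0 s \<Omega>. energy s \<Omega> \<mu> g w \<le> energy s \<Omega> \<mu> g u"
proof -
  let ?E = "energy s \<Omega> \<mu> g"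
  define I where "I = Inf (?E ` K)"
  have ne: "?E ` K \<noteq> {}"
    using trunc_in_K[OF X0_zero] by blast
  have bdd: "bdd_below (?E ` K)"
    using energy_K_bounded_below by (auto intro!: bdd_belowI)
  have I_le: "I \<le> ?E u" if "u \<in> K" for u
    unfolding I_def using bdd that by (intro cInf_lower) auto
  have "\<exists>u\<in>K. ?E u < I + (1/2)^n" for n
    using cInf_lessD[OF ne, of "I + (1/2)^n"] by (auto simp: I_def)
  then obtain u where uK: "\<And>n. u n \<in> K" and uE: "\<And>n. ?E (u n) < I + (1/2)^n"
    by metis
  \<comment> \<open>\<open>m n k\<close> is the maximum of
    \<open>u n, ..., u (n + k)\<close>.\<close>
  define m where "m n = rec_nat (u n) (\<lambda>k f x. max (f x) (u (n + Suc k) x))" for n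
  have m_0: "m n 0 = u n" and m_Suc: "m n (Suc k) = (\<lambda>x. max (m n k x) (u (n + Suc k) x))" for n k
    by (simp_all add: m_def)
  have mK: "m n k \<in> K" for n k
    by (induction k) (simp_all only: m_0 m_Suc uK K_max)
  \<comment> \<open>The right side is \<open>I\<close> plus the sum of \<open>(1/2)^j\<close> for
    \<open>j\<close> from \<open>n\<close> to \<open>n + k\<close>. Each new maximum adds only the
    excess of the new function over \<open>I\<close>, because the minimum has energy at least
    \<open>I\<close>.\<close>
  have mE: "?E (m n k) \<le> I + 2 * (1/2)^n - (1/2)^(n + k)" for n k
  proof (induction k)
    case 0
    then show ?case using uE[of n] by (simp add: m_0)
  next
    case (Suc k)
    have "?E (m n (Suc k)) + ?E (\<lambda>x. min (m n k x) (u (n + Suc k) x))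
        \<le> ?E (m n k) + ?E (u (n + Suc k))"
      unfolding m_Suc using mK uK by (intro energy_submodular) (auto simp: K_def)
    moreover have "I \<le> ?E (\<lambda>x. min (m n k x) (u (n + Suc k) x))"
      using K_min[OF mK uK] by (rule I_le)
    moreover have "(1/2::real)^(n + k) = 2 * (1/2)^(n + Suc k)"
      by simp
    ultimately show ?case
      using Suc uE[of "n + Suc k"] by linarith
  qed
  have m_bounds: "0 \<le> m n k x" "m n k x \<le> d" for n k x
    using mK by (auto simp: K_def)
  \<comment> \<open>The increasing limit of \<open>m n k\<close>, that is, the supremum of all
    \<open>u j\<close> with \<open>j >= n\<close>.\<close>
  define w where "w n x = (SUP k. m n k x)" for n x
  have m_bdd: "bdd_above (range (\<lambda>k. m n k x))" for n x
    using m_bounds by (auto intro!: bdd_aboveI)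
  have m_lim: "(\<lambda>k. m n k x) \<longlonglongrightarrow> w n x" for n x
    unfolding w_def by (rule LIMSEQ_incseq_SUP[OF m_bdd]) (auto simp: incseq_Suc_iff m_Suc)
  have wKE: "w n \<in> K \<and> ?E (w n) \<le> I + 2 * (1/2)^n" for n
  proof (rule energy_lower_semicontinuous[OF mK m_lim])
    show "?E (m n k) \<le> I + 2 * (1/2)^n" for k
      using mE[of n k] zero_le_power[of "1/2::real" "n + k"] by linarith
  qed
  have m_shift: "m (Suc n) k x \<le> m n (Suc k) x" for n k x
    by (induction k) (auto simp: m_0 m_Suc)
  have w_dec: "w (Suc n) x \<le> w n x" for n x
    unfolding w_def by (intro cSUP_least) (auto intro: cSUP_upper2[OF m_bdd] m_shift)
  \<comment> \<open>This is the pointwise upper limit of the sequence \<open>u\<close>.\<close>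
  define z where "z x = (INF n. w n x)" for x
  have z_lim: "(\<lambda>n. w n x) \<longlonglongrightarrow> z x" for x
    unfolding z_def
  proof (rule LIMSEQ_decseq_INF)
    show "bdd_below (range (\<lambda>n. w n x))"
      using wKE by (auto simp: K_def intro!: bdd_belowI)
  qed (auto simp: decseq_Suc_iff w_dec)
  \<comment> \<open>Discarding the first \<open>N\<close> terms leaves a sequence with the same
    limit whose energies all obey the bound for index \<open>N\<close>; afterwards \<open>N\<close>
    tends to infinity.\<close>
  have zN: "z \<in> K \<and> ?E z \<le> I + 2 * (1/2)^N" for N
  proof (rule energy_lower_semicontinuous)
    show "w (n + N) \<in> K" for n using wKE by blast
    show "(\<lambda>n. w (n + N) x) \<longlonglongrightarrow> z x" for x
      using z_lim by (rule LIMSEQ_ignore_initial_segment)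
    have "(1/2::real)^(n + N) \<le> (1/2)^N" for n
      by (rule power_decreasing) auto
    then show "?E (w (n + N)) \<le> I + 2 * (1/2)^N" for n
      using wKE[of "n + N"] by (smt (verit))
  qed
  have "(\<lambda>N. I + 2 * (1/2)^N) \<longlonglongrightarrow> I + 2 * 0"
    by (intro tendsto_intros LIMSEQ_power_zero) simp
  then have zI: "?E z \<le> I"
    using zN LIMSEQ_le_const[of "\<lambda>N. I + 2 * (1/2)^N" I "?E z"] by auto
  have "?E z \<le> ?E v" if "v \<in> X0 s \<Omega>" for v
    using zI I_le[OF trunc_in_K[OF that]] energy_trunc_le[OF that] by linarith
  then show ?thesis using zN by blast
qed

section \<open>First variation of the energy and the weak equation\<close>

lemma set_integrable_gext_mult:
  assumes "u \<in> X0 s \<Omega>" "\<phi> \<in> X0 s \<Omega>"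
  shows "set_integrable lborel \<Omega> (\<lambda>x. gext g (u x) * \<phi> x)"
proof -
  have [measurable]: "u \<in> borel_measurable borel" "\<phi> \<in> borel_measurable borel"
    using assms by auto
  show ?thesis
    by (rule set_integrable_bound_dom[OF _ set_integrable_scaled_abs[OF assms(2), of M]])
      (auto simp: abs_mult intro!: mult_right_mono abs_gext_le)
qed

text \<open>Differentiation under the integral: the Lipschitz bound dominates the difference
  quotients by \<open>M\<close> times the absolute value of \<open>\<phi>\<close>. The limit is
  tested along sequences so that dominated convergence applies.\<close>

lemma DERIV_integral_Gprim:
  assumes u: "u \<in> X0 s \<Omega>" and \<phi>: "\<phi> \<in> X0 s \<Omega>"
  shows "((\<lambda>t. LINT x:\<Omega>|lborel. Gprim g (u x + t * \<phi> x)) has_real_derivative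
          (LINT x:\<Omega>|lborel. gext g (u x) * \<phi> x)) (at 0)"
  unfolding DERIV_def LIMSEQ_SEQ_conv[symmetric]
proof (intro allI impI, elim conjE)
  fix S :: "nat \<Rightarrow> real"
  assume S: "\<forall>n. S n \<noteq> 0" "S \<longlonglongrightarrow> 0"
  have [measurable]: "u \<in> borel_measurable borel" "\<phi> \<in> borel_measurable borel"
    using u \<phi> by auto
  let ?q = "\<lambda>n x. (Gprim g (u x + S n * \<phi> x) - Gprim g (u x)) / S n"
  have "(\<lambda>n. LINT x:\<Omega>|lborel. ?q n x) \<longlonglongrightarrow> (LINT x:\<Omega>|lborel. gext g (u x) * \<phi> x)"
  proof (rule set_integral_dominated_convergence)
    show "set_integrable lborel \<Omega> (\<lambda>x. M * \<bar>\<phi> x\<bar>)"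
      using \<phi> by (rule set_integrable_scaled_abs)
    show "(\<lambda>n. ?q n x) \<longlonglongrightarrow> gext g (u x) * \<phi> x" for x
    proof -
      have "((\<lambda>t. Gprim g (u x + t * \<phi> x)) has_real_derivative gext g (u x + 0 * \<phi> x) * \<phi> x) (at 0)"
        by (rule DERIV_chain2[OF Gprim_DERIV]) (auto intro!: derivative_eq_intros)
      then show ?thesis
        using S unfolding DERIV_def LIMSEQ_SEQ_conv[symmetric] by simp
    qed
    show "\<bar>?q n x\<bar> \<le> M * \<bar>\<phi> x\<bar>" for n x
      using Gprim_Lipschitz[of "u x + S n * \<phi> x" "u x"] S
      by (simp add: abs_mult divide_le_eq mult.commute mult.left_commute)
  qed measurable
  \<comment> \<open>The terms \<open>0 + S n\<close> and \<open>0 * \<phi> x\<close> match the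
    quotient that \<open>DERIV_def\<close> produces at \<open>0\<close>.\<close>
  moreover have "(LINT x:\<Omega>|lborel. ?q n x)
      = ((LINT x:\<Omega>|lborel. Gprim g (u x + (0 + S n) * \<phi> x)) - (LINT x:\<Omega>|lborel. Gprim g (u x + 0 * \<phi> x))) / S n" for n
    using set_integrable_Gprim[OF u] set_integrable_Gprim[OF X0_add_scaled[OF u \<phi>, of "S n"]]
    by simp
  ultimately show "(\<lambda>n. ((LINT x:\<Omega>|lborel. Gprim g (u x + (0 + S n) * \<phi> x))
      - (LINT x:\<Omega>|lborel. Gprim g (u x + 0 * \<phi> x))) / S n)
      \<longlonglongrightarrow> (LINT x:\<Omega>|lborel. gext g (u x) * \<phi> x)"
    by (simp only:)
qed

text \<open>Minimality over the whole linear space allows variations of both signs along each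
  \<open>\<phi>\<close>, so the derivative of the energy at \<open>t = 0\<close> vanishes, and this
  is the weak equation.\<close>

lemma minimizer_weak_solution:
  assumes w: "w \<in> X0 s \<Omega>"
    and min: "\<And>u. u \<in> X0 s \<Omega> \<Longrightarrow> energy s \<Omega> \<mu> g w \<le> energy s \<Omega> \<mu> g u"
  shows "weak_solution s \<Omega> \<mu> g w"
  unfolding weak_solution_def gform_def[symmetric]
proof (intro conjI ballI w)
  fix \<phi> assume \<phi>: "\<phi> \<in> X0 s \<Omega>"
  let ?B = "\<lambda>u v. \<integral>z. gform s u v z \<partial>(lborel \<Otimes>\<^sub>M lborel)"
  let ?b = "\<lambda>u v. LINT x:\<Omega>|lborel. u x * v x"
  let ?G = "\<lambda>t. LINT x:\<Omega>|lborel. Gprim g (w x + t * \<phi> x)"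
  \<comment> \<open>Both quadratic terms are expanded in powers of \<open>t\<close>, leaving the
    primitive as the only term not polynomial in \<open>t\<close>.\<close>
  define e where "e t = 1/2 * (?B w w + 2 * t * ?B w \<phi> + t\<^sup>2 * ?B \<phi> \<phi>)
      + \<mu>/2 * (?b w w + 2 * t * ?b w \<phi> + t\<^sup>2 * ?b \<phi> \<phi>) - ?G t" for t
  have e: "energy s \<Omega> \<mu> g (\<lambda>x. w x + t * \<phi> x) = e t" for t
  proof -
    have "?B (\<lambda>x. w x + t * \<phi> x) (\<lambda>x. w x + t * \<phi> x)
        = ?B w w + 2 * t * ?B w \<phi> + t\<^sup>2 * ?B \<phi> \<phi>"
      unfolding gform_add_scaled
      using integrable_gform[OF w w] integrable_gform[OF w \<phi>] integrable_gform[OF \<phi> \<phi>] by simp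
    moreover have "(LINT x:\<Omega>|lborel. (w x + t * \<phi> x)\<^sup>2) = ?b w w + 2 * t * ?b w \<phi> + t\<^sup>2 * ?b \<phi> \<phi>"
    proof -
      have "(LINT x:\<Omega>|lborel. (w x + t * \<phi> x)\<^sup>2)
          = (LINT x:\<Omega>|lborel. w x * w x + (2 * t) * (w x * \<phi> x) + t\<^sup>2 * (\<phi> x * \<phi> x))"
        by (simp add: power2_eq_square algebra_simps)
      also have "\<dots> = ?b w w + 2 * t * ?b w \<phi> + t\<^sup>2 * ?b \<phi> \<phi>"
        using set_integrable_mult[OF w w] set_integrable_mult[OF w \<phi>] set_integrable_mult[OF \<phi> \<phi>]
        by (subst set_integral_add | subst set_integral_mult_right | simp)+
      finally show ?thesis .
    qed
    ultimately show ?thesis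
      unfolding energy_def enn2real_gagliardo[OF X0_add_scaled[OF w \<phi>]] e_def by simp
  qed
  have D: "(e has_real_derivative ?B w \<phi> + \<mu> * ?b w \<phi> - (LINT x:\<Omega>|lborel. gext g (w x) * \<phi> x)) (at 0)"
    unfolding e_def
    by (rule derivative_eq_intros DERIV_integral_Gprim[OF w \<phi>] refl | simp)+
  have "e 0 \<le> e t" for t
    using min[OF X0_add_scaled[OF w \<phi>, of t]] e[of 0] e[of t] by simp
  then have "?B w \<phi> + \<mu> * ?b w \<phi> - (LINT x:\<Omega>|lborel. gext g (w x) * \<phi> x) = 0"
    by (intro DERIV_local_min[OF D zero_less_one]) simp
  then show "?B w \<phi> + \<mu> * ?b w \<phi> = (LINT x:\<Omega>|lborel. gext g (w x) * \<phi> x)"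
    by simp
qed

end

section \<open>Return from the modified nonlinearity to the original one\<close>

lemma Gprim_cong:
  assumes "\<And>\<tau>. \<tau> \<le> b \<Longrightarrow> gext g \<tau> = gext h \<tau>" "t \<le> b" "0 \<le> b"
  shows "Gprim g t = Gprim h t"
  \<comment> \<open>The integration interval joins \<open>0\<close> and \<open>t\<close> in either
    order; as both are at most \<open>b\<close>, it lies where the extensions agree.\<close>
  unfolding Gprim_def using assms
  by (intro interval_integral_cong)
    (auto simp: einterval_def max_def zero_ereal_def split: if_splits)

theorem theorem3p1:
  fixes \<Omega> :: "'a::euclidean_space set"
    and s \<mu> \<delta> \<eta> :: real and g :: "real \<Rightarrow> real"
  assumes dom: "bounded_smooth_domain \<Omega>"
    and s: "0 < s" "s < 1"
    and N: "real DIM('a) > 2 * s"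
    and mu: "\<mu> > 0"
    and g1: "continuous_on {0..} g" "bounded (g ` {0..})" "g 0 = 0"
    and g2: "0 < \<delta>" "\<delta> < \<eta>" "\<forall>t\<in>{\<delta>..\<eta>}. g t \<le> 0"
  shows "\<exists>u0 \<in> E_eta s \<Omega> \<eta>.
           (\<forall>u \<in> E_eta s \<Omega> \<eta>. energy s \<Omega> \<mu> g u0 \<le> energy s \<Omega> \<mu> g u)
         \<and> weak_solution s \<Omega> \<mu> g u0
         \<and> (AE x in lborel. x \<in> \<Omega> \<longrightarrow> 0 \<le> u0 x \<and> u0 x \<le> \<delta>)"
proof -
  \<comment> \<open>\<open>h\<close> keeps the continuity and the bound \<open>M\<close>, and the
    value \<open>g \<eta> \<le> 0\<close> makes it nonpositive on all of
    \<open>[\<delta>, \<infinity>)\<close>.\<close>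
  define h where "h t = g (min t \<eta>)" for t
  obtain M where M: "\<And>t. 0 \<le> t \<Longrightarrow> \<bar>g t\<bar> \<le> M"
    using g1(2) unfolding bounded_iff by auto
  \<comment> \<open>Provides measurability of \<open>Gprim g\<close> for comparing the two
    energies.\<close>
  interpret orig: bounded_nonlinearity g M
    using g1 M by unfold_locales auto
  interpret fractional_problem h M \<Omega> s \<mu> \<delta>
  proof unfold_locales
    show "continuous_on {0..} h"
      unfolding h_def
      by (rule continuous_on_compose2[OF g1(1)]) (use g2 in \<open>auto intro!: continuous_intros\<close>)
  qed (use g1 g2 M mu dom in \<open>auto simp: h_def bounded_smooth_domain_def\<close>)
  have gext_eq: "gext h t = gext g t" if "t \<le> \<eta>" for t
    using that by (simp add: gext_def h_def)
  have Gprim_eq: "Gprim h t = Gprim g t" if "t \<le> \<eta>" for t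
    by (rule Gprim_cong[OF gext_eq that]) (use g2 in auto)
  have energy_eq: "energy s \<Omega> \<mu> h u = energy s \<Omega> \<mu> g u" if "u \<in> E_eta s \<Omega> \<eta>" for u
  proof -
    have [measurable]: "u \<in> borel_measurable borel"
      using that by (auto simp: E_eta_def)
    have "AE x in lborel. x \<in> \<Omega> \<longrightarrow> \<bar>u x\<bar> \<le> \<eta>"
      using that by (simp add: E_eta_def)
    then have "(LINT x:\<Omega>|lborel. Gprim h (u x)) = (LINT x:\<Omega>|lborel. Gprim g (u x))"
      by (intro set_lebesgue_integral_cong_AE) (auto elim!: eventually_mono intro!: Gprim_eq)
    then show ?thesis by (simp add: energy_def)
  qed
  obtain w where wK: "w \<in> K"
    and min: "\<And>u. u \<in> X0 s \<Omega> \<Longrightarrow> energy s \<Omega> \<mu> h w \<le> energy s \<Omega> \<mu> h u"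
    using exists_minimizer by blast
  have w: "w \<in> X0 s \<Omega>" and r: "0 \<le> w x" "w x \<le> \<delta>" for x
    using wK by (auto simp: K_def)
  have wE: "w \<in> E_eta s \<Omega> \<eta>"
    unfolding E_eta_def using w r order_trans[OF r(2) less_imp_le[OF g2(2)]]
    by (auto intro!: always_eventually)
  have "energy s \<Omega> \<mu> g w \<le> energy s \<Omega> \<mu> g u" if "u \<in> E_eta s \<Omega> \<eta>" for u
    using min[of u] energy_eq[OF wE] energy_eq[OF that] that by (simp add: E_eta_def)
  \<comment> \<open>The values of \<open>w\<close> stay below \<delta> < \<eta>, where the
    modification is invisible, so the equation for \<open>h\<close> is the equation for
    \<open>g\<close>.\<close>
  moreover have "gext h (w x) = gext g (w x)" for x
    using r[of x] g2 by (intro gext_eq) simp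
  then have "weak_solution s \<Omega> \<mu> g w"
    using minimizer_weak_solution[OF w min] by (simp add: weak_solution_def)
  ultimately show ?thesis
    using wE r by blast
qed

end
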